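(* Let $V_{\rm s}>0$ and $V_1,\dots,V_q>0$ (volumes), let $q_1,\dots,q_q>0$ be constant mass flows, and let the constant $\kappa$ be the coefficient of the heat-loss term of the producer. Consider the district heating delay system with state $(\hat T_{\rm in},\hat T_1,\dots,\hat T_q)\in\mathbb{R}^{q+1}$, delays $0<\tau_1\le\dots\le\tau_q$ and inputs $P_h,w_1,\dots,w_q$, given for $t\ge0$ by $$\frac{\mathrm{d}}{\mathrm{d}t}\hat T_{\rm in}(t)=-\frac{\sum_{i=1}^q q_i+\kappa}{V_{\rm s}}\hat T_{\rm in}(t)+\sum_{i=1}^q\frac{q_i}{\sqrt{V_{\rm s}}\sqrt{V_i}}\hat T_i(t)+\frac{1}{\sqrt{V_{\rm s}}}P_h(t),$$ $$\frac{\mathrm{d}}{\mathrm{d}t}\hat T_i(t)=-\frac{q_i}{V_i}\hat T_i(t)+\frac{q_i}{\sqrt{V_{\rm s}}\sqrt{V_i}}\hat T_{\rm in}(t-\tau_i)-\frac{1}{\sqrt{V_i}}w_i(t),\qquad i=1,\dots,q.$$ This system is exponentially stable independently of the delay if $V_{\rm s}\ge\max_{i=1,\dots,q}V_i$.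
   Context: Stability refers to the zero-input system ($P_h=0$, $w_i=0$). A linear delay system with state $x(t)\in\mathbb{R}^n$, largest delay $\tau$ and initial condition $x(t)=\phi(t)$ on $[-\tau,0]$ is (globally) exponentially stable if there exist constants $b>0$ and $c\ge1$ such that for all initial histories $\phi\in C([-\tau,0],\mathbb{R}^n)$ the solution satisfies $\|x(t)\|\le ce^{-bt}\|\phi\|_\infty$ for all $t\ge0$, where $\|\phi\|_\infty=\sup_{s\in[-\tau,0]}\|\phi(s)\|$ and $\|\cdot\|$ is the Euclidean norm. "Independently of the delay" means that this holds for all values of the delays. In the underlying model the heat-loss term is $-\kappa T_{\rm in}$ in the equation $V_{\rm s}\dot T_{\rm in}=\sum_{i=1}^q q_i(T_i-T_{\rm in})-\kappa T_{\rm in}+P_h$, with $\hat T_{\rm in}=\sqrt{V_{\rm s}}\,T_{\rm in}$ and $\hat T_i=\sqrt{V_i}\,T_i$.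
   Formalization: The heat-loss coefficient κ is assumed strictly positive; for κ = 0 the constants T̂_in = √V_s, T̂_i = √V_i solve the zero-input system without decaying, and for κ < 0 there is a growing exponential solution. *)

theory Defs
  imports "HOL-Analysis.Analysis"
begin

text \<open>
  A delay system is given by its right-hand side \<open>F x t\<close>, which may depend on the values of the
  trajectory \<open>x\<close> at time \<open>t\<close> and at earlier times.  A solution with history \<open>\<phi>\<close> is a continuous
  function on \<open>[-r, \<infinity>)\<close> (\<open>r\<close> being the largest delay); the derivative at \<open>t = 0\<close> is one-sided,
  since the history need not be differentiable.
\<close>

definition delay_solution ::
  "real \<Rightarrow> ((real \<Rightarrow> 'a) \<Rightarrow> real \<Rightarrow> 'a) \<Rightarrow> (real \<Rightarrow> 'a) \<Rightarrow> (real \<Rightarrow> 'a::euclidean_space) \<Rightarrow> bool"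
where
  "delay_solution r F \<phi> x \<longleftrightarrow>
     continuous_on {-r..} x \<and>
     (\<forall>s\<in>{-r..0}. x s = \<phi> s) \<and>
     (\<forall>t\<ge>0. (x has_vector_derivative F x t) (at t within {0..}))"

definition exponentially_stable ::
  "real \<Rightarrow> ((real \<Rightarrow> 'a) \<Rightarrow> real \<Rightarrow> 'a::euclidean_space) \<Rightarrow> bool"
where
  "exponentially_stable r F \<longleftrightarrow>
     (\<exists>b c. b > 0 \<and> c \<ge> 1 \<and>
        (\<forall>\<phi>. continuous_on {-r..0} \<phi> \<longrightarrow>
           (\<forall>x. delay_solution r F \<phi> x \<longrightarrow>
              (\<forall>t\<ge>0. norm (x t) \<le> c * exp (- b * t) * (SUP s\<in>{-r..0}. norm (\<phi> s))))))"

text \<open>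
  The index type \<open>'q\<close> stands for \<open>{1, \<dots>, q}\<close>.  The state space \<open>\<real>\<^sup>q\<^sup>+\<^sup>1\<close> is \<open>real \<times> (real ^ 'q)\<close>, whose
  norm is the Euclidean one; the first component of a state is the scaled temperature of the
  producer, the second one collects the scaled temperatures of the consumers.
\<close>

definition district_heating ::
  "real \<Rightarrow> ('q \<Rightarrow> real) \<Rightarrow> ('q \<Rightarrow> real) \<Rightarrow> real \<Rightarrow> ('q \<Rightarrow> real) \<Rightarrow>
   (real \<Rightarrow> real) \<Rightarrow> ('q \<Rightarrow> real \<Rightarrow> real) \<Rightarrow>
   (real \<Rightarrow> real \<times> (real ^ 'q::finite)) \<Rightarrow> real \<Rightarrow> real \<times> (real ^ 'q)"
where
  "district_heating Vs V q \<kappa> \<tau> Ph w x t =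
     (- (((\<Sum>i\<in>UNIV. q i) + \<kappa>) / Vs) * fst (x t)
        + (\<Sum>i\<in>UNIV. q i / (sqrt Vs * sqrt (V i)) * (snd (x t) $ i))
        + 1 / sqrt Vs * Ph t,
      \<chi> i. - (q i / V i) * (snd (x t) $ i)
        + q i / (sqrt Vs * sqrt (V i)) * fst (x (t - \<tau> i))
        - 1 / sqrt (V i) * w i t)"

text \<open>Stability refers to the system with zero inputs.\<close>

definition district_heating_stable_indep_delay ::
  "real \<Rightarrow> ('q::{finite,linorder} \<Rightarrow> real) \<Rightarrow> ('q \<Rightarrow> real) \<Rightarrow> real \<Rightarrow> bool"
where
  "district_heating_stable_indep_delay Vs V q \<kappa> \<longleftrightarrow>
     (\<forall>\<tau>. (\<forall>i. 0 < \<tau> i) \<and> mono \<tau> \<longrightarrow>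
        exponentially_stable (Max (range \<tau>))
          (district_heating Vs V q \<kappa> \<tau> (\<lambda>t. 0) (\<lambda>i t. 0)))"

end

theory Submission
  imports Defs
begin

text \<open>
  In the unscaled temperatures the equations read
  \<open>V\<^sub>s T\<^sub>i\<^sub>n' = \<Sum> q\<^sub>i (T\<^sub>i - T\<^sub>i\<^sub>n) - \<kappa> T\<^sub>i\<^sub>n\<close> and \<open>V\<^sub>i T\<^sub>i' = q\<^sub>i (T\<^sub>i\<^sub>n(t - \<tau>\<^sub>i) - T\<^sub>i)\<close>.  All couplings are
  nonnegative, and since \<open>\<kappa> > 0\<close> the weights \<open>1\<close> for the producer and \<open>1 + \<kappa> / (2 \<Sum> q\<^sub>i)\<close> for the
  consumers make every row strictly diagonally dominant.  Hence, for small \<open>b > 0\<close>, the weights times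
  \<open>K exp (- b t)\<close> form an envelope: as long as no component has left it, the variation of constants
  inequality shows that every component is strictly inside, so there is no first time at which the
  envelope is touched.
\<close>

text \<open>A continuation argument: a failure would have an earliest time, the failure times in
  \<open>{0..t}\<close> being a finite union of compact sets. Up to that time the premise of
  \<open>step\<close> holds, and its conclusion contradicts the failure.\<close>

lemma first_contact:
  fixes g :: "'j::finite \<Rightarrow> real \<Rightarrow> real"
  assumes cont: "\<And>j. continuous_on {0..} (g j)"
    and step: "\<And>T j. T \<ge> 0 \<Longrightarrow> (\<And>s k. 0 \<le> s \<Longrightarrow> s \<le> T \<Longrightarrow> g k s \<le> 0) \<Longrightarrow> g j T < 0"
    and init: "\<And>j. g j 0 < 0"
    and "t \<ge> 0"
  shows "g j t < 0"
proof (rule ccontr)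
  assume "\<not> g j t < 0"
  define S where "S = (\<Union>k. {s\<in>{0..t}. 0 \<le> g k s})"
  have cont': "continuous_on {0..u} (g k)" for k u
    by (rule continuous_on_subset[OF cont]) auto
  have "closed {s\<in>{0..t}. 0 \<le> g k s}" for k
    using continuous_closed_preimage[OF cont'[of t k], of "{0..}"]
    by (simp add: vimage_def Int_def)
  then have "compact {s\<in>{0..t}. 0 \<le> g k s}" for k
    by (metis (no_types, lifting) compact_Icc compact_eq_bounded_closed bounded_subset mem_Collect_eq subsetI)
  then have "compact S"
    unfolding S_def by (intro compact_UN) auto
  moreover have "t \<in> S"
    using \<open>\<not> g j t < 0\<close> \<open>t \<ge> 0\<close> unfolding S_def by (auto simp: not_less)
  ultimately obtain T where T: "T \<in> S" "\<And>s. s \<in> S \<Longrightarrow> T \<le> s"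
    using compact_attains_inf[of S] by blast
  then obtain k where k: "0 \<le> g k T" and T0: "0 \<le> T" "T \<le> t"
    by (auto simp: S_def)
  \<comment> \<open>Every component starts negative, so a positive value is preceded by a zero,
    which already lies in \<open>S\<close>; minimality of \<open>T\<close> leaves no room for
    it.\<close>
  have le: "g l s \<le> 0" if "0 \<le> s" "s \<le> T" for l s
  proof (rule ccontr)
    assume pos: "\<not> g l s \<le> 0"
    obtain z where z: "0 \<le> z" "z \<le> s" "g l z = 0"
      using IVT'[of "g l" 0 0 s, OF _ _ \<open>0 \<le> s\<close> cont'] init[of l] pos by auto
    then have "z \<in> S"
      using that T0 unfolding S_def by (auto intro!: exI[of _ l])
    then have "z = s"
      using T(2) z that by fastforce
    with z pos show False by simp
  qed
  show False
    using step[OF T0(1) le, of k] k by simp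
qed

text \<open>Variation of constants without integrals: the bound on \<open>f\<close> makes
  \<open>C * exp (- b * t)\<close> a supersolution of the equation for \<open>y\<close>, and the
  integrating factor \<open>exp (a * t)\<close> turns the comparison into monotonicity. The strict
  inequality at time 0 thus survives up to \<open>T\<close>.\<close>

lemma exp_envelope_upper:
  fixes y f :: "real \<Rightarrow> real"
  assumes "T \<ge> 0"
    and deriv: "\<And>t. t \<ge> 0 \<Longrightarrow> (y has_real_derivative - a * y t + f t) (at t within {0..})"
    and f: "\<And>t. 0 \<le> t \<Longrightarrow> t \<le> T \<Longrightarrow> f t \<le> (a - b) * C * exp (- b * t)"
    and "y 0 < C"
  shows "y T < C * exp (- b * T)"
proof (cases "T = 0")
  case False
  with \<open>T \<ge> 0\<close> have "T > 0" by simp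
  \<comment> \<open>\<open>z\<close> is the signed gap \<open>y t - C * exp (- b * t)\<close> times
    the integrating factor.\<close>
  define z where "z t = exp (a * t) * y t - C * exp ((a - b) * t)" for t
  have "continuous_on {0..} y"
    using deriv by (auto simp: continuous_on_eq_continuous_within intro!: DERIV_continuous)
  then have "continuous_on {0..T} y"
    by (rule continuous_on_subset) auto
  then have cont: "continuous_on {0..T} z"
    unfolding z_def by (intro continuous_intros)
  have "z T \<le> z 0"
  proof (rule DERIV_nonpos_imp_decreasing_open[OF \<open>T \<ge> 0\<close> _ cont])
    fix t assume t: "0 < t" "t < T"
    then have "at t within {0..} = at t"
      by (intro at_within_interior) simp
    then have "(y has_real_derivative - a * y t + f t) (at t)"
      using deriv[of t] t by simp
    then have "(z has_real_derivative exp (a * t) * f t - (a - b) * C * exp ((a - b) * t)) (at t)"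
      unfolding z_def by (auto intro!: derivative_eq_intros simp: algebra_simps)
    moreover have "exp (a * t) * f t \<le> exp (a * t) * ((a - b) * C * exp (- b * t))"
      using f[of t] t by simp
    then have "exp (a * t) * f t - (a - b) * C * exp ((a - b) * t) \<le> 0"
      by (simp add: exp_diff exp_minus field_simps)
    ultimately show "\<exists>d. (z has_real_derivative d) (at t) \<and> d \<le> 0" by blast
  qed
  also have "z 0 < 0"
    using \<open>y 0 < C\<close> by (simp add: z_def)
  finally have "exp (a * T) * y T < exp (a * T) * (C * exp (- b * T))"
    by (simp add: z_def exp_diff exp_minus field_simps)
  then show ?thesis by simp
qed (use assms in simp)

text \<open>By linearity the one-sided estimate applies to \<open>y\<close> with forcing
  \<open>f\<close> and to \<open>- y\<close> with forcing \<open>- f\<close>.\<close>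

lemma exp_envelope:
  fixes y f :: "real \<Rightarrow> real"
  assumes "T \<ge> 0"
    and deriv: "\<And>t. t \<ge> 0 \<Longrightarrow> (y has_real_derivative - a * y t + f t) (at t within {0..})"
    and f: "\<And>t. 0 \<le> t \<Longrightarrow> t \<le> T \<Longrightarrow> \<bar>f t\<bar> \<le> (a - b) * C * exp (- b * t)"
    and "\<bar>y 0\<bar> < C"
  shows "\<bar>y T\<bar> < C * exp (- b * T)"
proof -
  have "y T < C * exp (- b * T)"
    using assms by (intro exp_envelope_upper[OF \<open>T \<ge> 0\<close> deriv]) (auto simp: abs_le_iff)
  moreover have "- y T < C * exp (- b * T)"
  proof (rule exp_envelope_upper[where a = a and f = "\<lambda>t. - f t" and y = "\<lambda>t. - y t", OF \<open>T \<ge> 0\<close>])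
    show "((\<lambda>t. - y t) has_real_derivative - a * - y t + - f t) (at t within {0..})" if "t \<ge> 0" for t
      using DERIV_minus[OF deriv[OF that]] by simp
    show "- f t \<le> (a - b) * C * exp (- b * t)" if "0 \<le> t" "t \<le> T" for t
      using f[OF that] by (simp add: abs_le_iff)
  qed (use \<open>\<bar>y 0\<bar> < C\<close> in simp)
  ultimately show ?thesis by simp
qed

text \<open>At \<open>b = 0\<close> both inequalities are strict, the second because
  \<open>q i < q i * (1 + \<epsilon>)\<close>. Continuity in \<open>b\<close> and the finite index
  type keep them for all small positive \<open>b\<close>.\<close>

lemma decay_rate_exists:
  fixes V q \<tau> :: "'q::finite \<Rightarrow> real"
  assumes "Vs > 0" "\<delta> > 0" "\<epsilon> > 0" "\<And>i. q i > 0"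
  shows "\<exists>b>0. b * Vs \<le> \<delta> \<and> (\<forall>i. q i * exp (b * \<tau> i) \<le> (q i - b * V i) * (1 + \<epsilon>))"
proof -
  have "\<forall>\<^sub>F b in at_right 0. 0 < (q i - b * V i) * (1 + \<epsilon>) - q i * exp (b * \<tau> i)" for i
  proof (rule order_tendstoD(1))
    show "((\<lambda>b. (q i - b * V i) * (1 + \<epsilon>) - q i * exp (b * \<tau> i)) \<longlongrightarrow>
        (q i - 0 * V i) * (1 + \<epsilon>) - q i * exp (0 * \<tau> i)) (at_right 0)"
      by (intro tendsto_intros)
    show "0 < (q i - 0 * V i) * (1 + \<epsilon>) - q i * exp (0 * \<tau> i)"
      using assms by (simp add: algebra_simps)
  qed
  then have "\<forall>\<^sub>F b in at_right 0. \<forall>i. 0 < (q i - b * V i) * (1 + \<epsilon>) - q i * exp (b * \<tau> i)"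
    by (simp add: eventually_all_finite)
  moreover have "\<forall>\<^sub>F b in at_right 0. b \<in> {0<..<\<delta> / Vs}"
    using assms by (intro eventually_at_right_real) simp
  ultimately have "\<forall>\<^sub>F b in at_right (0::real). b > 0 \<and> b * Vs \<le> \<delta> \<and>
      (\<forall>i. q i * exp (b * \<tau> i) \<le> (q i - b * V i) * (1 + \<epsilon>))"
    by eventually_elim (use assms in \<open>auto simp: field_simps less_imp_le\<close>)
  then show ?thesis
    using eventually_happens'[OF trivial_limit_at_right_real] by blast
qed

text \<open>The weights 1 and \<open>1 + \<epsilon>\<close> of the unscaled temperatures become
  \<open>sqrt Vs\<close> and \<open>sqrt (V i) * (1 + \<epsilon>)\<close> after scaling.
  \<open>producer\<close> and \<open>consumer\<close> are the rows of the supersolution condition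
  for the envelope. Only the producer enters with a delay, so the consumers are constrained at time
  0 alone.\<close>

lemma district_heating_envelope:
  fixes V q \<tau> :: "'q::finite \<Rightarrow> real" and x :: "real \<Rightarrow> real \<times> (real ^ 'q)"
  assumes pos: "Vs > 0" "\<And>i. V i > 0" "\<And>i. q i > 0"
    and \<tau>: "\<And>i. 0 \<le> \<tau> i" "\<And>i. \<tau> i \<le> r"
    and "b \<ge> 0" "K > 0"
    and producer: "(1 + \<epsilon>) * (\<Sum>i\<in>UNIV. q i) \<le> (\<Sum>i\<in>UNIV. q i) + \<kappa> - b * Vs"
    and consumer: "\<And>i. q i * exp (b * \<tau> i) \<le> (q i - b * V i) * (1 + \<epsilon>)"
    and sol: "delay_solution r (district_heating Vs V q \<kappa> \<tau> (\<lambda>t. 0) (\<lambda>i t. 0)) \<phi> x"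
    and hist0: "\<And>s. -r \<le> s \<Longrightarrow> s \<le> 0 \<Longrightarrow> \<bar>fst (\<phi> s)\<bar> < K * sqrt Vs"
    and hist: "\<And>i. \<bar>snd (\<phi> 0) $ i\<bar> < K * (sqrt (V i) * (1 + \<epsilon>))"
    and "t \<ge> 0"
  shows "\<bar>fst (x t)\<bar> < K * sqrt Vs * exp (- b * t)" (is ?P)
    and "\<bar>snd (x t) $ i\<bar> < K * (sqrt (V i) * (1 + \<epsilon>)) * exp (- b * t)" (is ?C)
proof -
  define c where "c i = q i / (sqrt Vs * sqrt (V i))" for i
  define p where "p i = sqrt (V i) * (1 + \<epsilon>)" for i
  define A where "A = ((\<Sum>i\<in>UNIV. q i) + \<kappa>) / Vs"
  have c0: "c i > 0" for i
    using pos by (simp add: c_def)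
  have r0: "r \<ge> 0"
    using \<tau>[of i] by simp
  \<comment> \<open>The producer row: \<open>sqrt (V i)\<close> cancels between coupling and weight,
    leaving \<open>producer\<close> divided by \<open>sqrt Vs\<close>.\<close>
  have cp: "(\<Sum>i\<in>UNIV. c i * p i) \<le> (A - b) * sqrt Vs"
  proof -
    have "c i * p i = (1 + \<epsilon>) * q i / sqrt Vs" for i
      using pos(2)[of i] by (simp add: c_def p_def)
    then have "(\<Sum>i\<in>UNIV. c i * p i) = (1 + \<epsilon>) * (\<Sum>i\<in>UNIV. q i) / sqrt Vs"
      by (simp add: sum_divide_distrib sum_distrib_left)
    also have "\<dots> \<le> ((\<Sum>i\<in>UNIV. q i) + \<kappa> - b * Vs) / sqrt Vs"
      using producer pos by (simp add: divide_right_mono)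
    also have "\<dots> = (A * Vs - b * Vs) / sqrt Vs"
      using pos by (simp add: A_def)
    also have "\<dots> = (A - b) * sqrt Vs"
      using pos(1) by (simp add: real_div_sqrt flip: left_diff_distrib times_divide_eq_right)
    finally show ?thesis .
  qed
  \<comment> \<open>The consumer row: \<open>consumer\<close> divided by \<open>sqrt (V i)\<close>.
    The factor \<open>exp (b * \<tau> i)\<close> is the ratio of the envelope at the delayed time to
    the envelope now.\<close>
  have pc: "c i * sqrt Vs * exp (b * \<tau> i) \<le> (q i / V i - b) * p i" for i
  proof -
    have "c i * sqrt Vs * exp (b * \<tau> i) = q i * exp (b * \<tau> i) / sqrt (V i)"
      using pos(1) by (simp add: c_def)
    also have "\<dots> \<le> (q i - b * V i) * (1 + \<epsilon>) / sqrt (V i)"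
      using consumer pos(2) by (simp add: divide_right_mono less_imp_le)
    also have "\<dots> = (q i / V i - b) * (V i / sqrt (V i)) * (1 + \<epsilon>)"
      using pos(2)[of i] by (simp add: field_simps)
    finally show ?thesis
      using pos(2)[of i] by (simp add: p_def real_div_sqrt mult.assoc)
  qed
  have contx: "continuous_on {-r..} x"
    and xh: "\<And>s. -r \<le> s \<Longrightarrow> s \<le> 0 \<Longrightarrow> x s = \<phi> s"
    and dx: "\<And>t. t \<ge> 0 \<Longrightarrow> (x has_vector_derivative
      district_heating Vs V q \<kappa> \<tau> (\<lambda>t. 0) (\<lambda>i t. 0) x t) (at t within {0..})"
    using sol by (auto simp: delay_solution_def)
  have d0: "((\<lambda>t. fst (x t)) has_real_derivative - A * fst (x t) + (\<Sum>i\<in>UNIV. c i * snd (x t) $ i))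
      (at t within {0..})" if "t \<ge> 0" for t
    using bounded_linear.has_vector_derivative[OF bounded_linear_fst dx[OF that]]
    by (simp add: district_heating_def has_real_derivative_iff_has_vector_derivative A_def c_def)
  have d1: "((\<lambda>t. snd (x t) $ i) has_real_derivative - (q i / V i) * snd (x t) $ i + c i * fst (x (t - \<tau> i)))
      (at t within {0..})" if "t \<ge> 0" for t i
    using bounded_linear.has_vector_derivative[OF
        bounded_linear_compose[OF bounded_linear_vec_nth bounded_linear_snd] dx[OF that]]
    by (simp add: district_heating_def has_real_derivative_iff_has_vector_derivative c_def)
  \<comment> \<open>The option type joins the producer (\<open>None\<close>) and the consumers
    (\<open>Some i\<close>) into one finite family, so that a first contact is sought among all
    components at once.\<close>
  define g where "g j t = (case j of
      None \<Rightarrow> \<bar>fst (x t)\<bar> - K * sqrt Vs * exp (- b * t)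
    | Some i \<Rightarrow> \<bar>snd (x t) $ i\<bar> - K * p i * exp (- b * t))" for j t
  have "g j t < 0" for j
  proof (rule first_contact[of g])
    have "continuous_on {0..} x"
      by (rule continuous_on_subset[OF contx]) (use r0 in auto)
    then show "continuous_on {0..} (g j)" for j
      unfolding g_def by (cases j) (auto intro!: continuous_intros)
    show init: "g j 0 < 0" for j
      using hist0[of 0] hist xh[of 0] r0 by (cases j) (auto simp: g_def p_def)
    fix T j assume "T \<ge> 0" and le: "\<And>s k. 0 \<le> s \<Longrightarrow> s \<le> T \<Longrightarrow> g k s \<le> 0"
    \<comment> \<open>The delayed argument may fall into the history. There \<open>hist0\<close>
      suffices, because \<open>exp (- b * s)\<close> is at least 1 for negative
      \<open>s\<close>.\<close>
    have le0: "\<bar>fst (x s)\<bar> \<le> K * sqrt Vs * exp (- b * s)" if "-r \<le> s" "s \<le> T" for s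
    proof (cases "s \<ge> 0")
      case True
      then show ?thesis using le[of s None] that by (simp add: g_def)
    next
      case False
      then have "K * sqrt Vs * 1 \<le> K * sqrt Vs * exp (- b * s)"
        using \<open>b \<ge> 0\<close> \<open>K > 0\<close> pos(1) by (intro mult_left_mono) (auto simp: mult_nonneg_nonpos)
      then show ?thesis using hist0[of s] xh[of s] False that by simp
    qed
    have le1: "\<bar>snd (x s) $ i\<bar> \<le> K * p i * exp (- b * s)" if "0 \<le> s" "s \<le> T" for s i
      using le[of s "Some i"] that by (simp add: g_def)
    show "g j T < 0"
    proof (cases j)
      case None
      have "\<bar>fst (x T)\<bar> < K * sqrt Vs * exp (- b * T)"
      proof (rule exp_envelope[OF \<open>T \<ge> 0\<close> d0])
        fix s assume s: "0 \<le> s" "s \<le> T"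
        have "\<bar>\<Sum>i\<in>UNIV. c i * snd (x s) $ i\<bar> \<le> (\<Sum>i\<in>UNIV. c i * (K * p i * exp (- b * s)))"
          using le1[OF s] c0
          by (intro order.trans[OF sum_abs] sum_mono) (simp add: abs_mult less_imp_le mult.assoc)
        also have "\<dots> = (\<Sum>i\<in>UNIV. c i * p i) * (K * exp (- b * s))"
          by (simp add: sum_distrib_left sum_distrib_right mult_ac)
        also have "\<dots> \<le> (A - b) * sqrt Vs * (K * exp (- b * s))"
          using cp \<open>K > 0\<close> by (intro mult_right_mono) auto
        finally show "\<bar>\<Sum>i\<in>UNIV. c i * snd (x s) $ i\<bar> \<le> (A - b) * (K * sqrt Vs) * exp (- b * s)"
          by (simp add: mult_ac)
      qed (use init[of None] in \<open>auto simp: g_def\<close>)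
      then show ?thesis by (simp add: g_def None)
    next
      case (Some i)
      have "\<bar>snd (x T) $ i\<bar> < K * p i * exp (- b * T)"
      proof (rule exp_envelope[OF \<open>T \<ge> 0\<close> d1])
        fix s assume s: "0 \<le> s" "s \<le> T"
        have "\<bar>c i * fst (x (s - \<tau> i))\<bar> \<le> c i * (K * sqrt Vs * exp (- b * (s - \<tau> i)))"
          using le0[of "s - \<tau> i"] s \<tau>[of i] c0[of i] by (simp add: abs_mult)
        also have "\<dots> = c i * sqrt Vs * exp (b * \<tau> i) * (K * exp (- b * s))"
          by (simp add: right_diff_distrib exp_diff exp_minus field_simps)
        also have "\<dots> \<le> (q i / V i - b) * p i * (K * exp (- b * s))"
          using pc \<open>K > 0\<close> by (intro mult_right_mono) auto
        finally show "\<bar>c i * fst (x (s - \<tau> i))\<bar> \<le> (q i / V i - b) * (K * p i) * exp (- b * s)"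
          by (simp add: mult_ac)
      qed (use init[of "Some i"] in \<open>auto simp: g_def\<close>)
      then show ?thesis by (simp add: g_def Some)
    qed
  qed (rule \<open>t \<ge> 0\<close>)
  from this[of None] this[of "Some i"] show ?P ?C
    by (simp_all add: g_def p_def)
qed

theorem proposition4p1:
  fixes Vs \<kappa> :: real
    and V q :: "'q::{finite,linorder} \<Rightarrow> real"
  assumes "Vs > 0"
    and "\<And>i. V i > 0"
    and "\<And>i. q i > 0"
    and "\<kappa> > 0"
    and "Vs \<ge> Max (range V)"
  shows "district_heating_stable_indep_delay Vs V q \<kappa>"
  unfolding district_heating_stable_indep_delay_def
proof (intro allI impI)
  fix \<tau> :: "'q \<Rightarrow> real"
  assume \<tau>: "(\<forall>i. 0 < \<tau> i) \<and> mono \<tau>"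
  define r where "r = Max (range \<tau>)"
  have \<tau>r: "\<tau> i \<le> r" for i
    by (simp add: r_def)
  then have r0: "r \<ge> 0"
    using \<tau> by (meson less_imp_le order.trans)
  define Q where "Q = (\<Sum>i\<in>UNIV. q i)"
  have "Q > 0"
    unfolding Q_def using assms(3) by (intro sum_pos) auto
  \<comment> \<open>This splits the heat loss: half of \<kappa> pays for the heavier consumer
    weights, the other half is left for the decay rate through \<open>b * Vs\<close>.\<close>
  define \<epsilon> where "\<epsilon> = \<kappa> / (2 * Q)"
  have "\<epsilon> > 0" and \<epsilon>Q: "\<epsilon> * Q = \<kappa> / 2"
    using \<open>\<kappa> > 0\<close> \<open>Q > 0\<close> by (simp_all add: \<epsilon>_def)
  obtain b where b: "b > 0" "b * Vs \<le> \<kappa> / 2"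
      "\<And>i. q i * exp (b * \<tau> i) \<le> (q i - b * V i) * (1 + \<epsilon>)"
    using decay_rate_exists[OF \<open>Vs > 0\<close>, of "\<kappa> / 2" \<epsilon> q \<tau> V] assms \<open>\<epsilon> > 0\<close> by auto
  define p where "p i = sqrt (V i) * (1 + \<epsilon>)" for i
  have p0: "p i > 0" for i
    using assms(2) \<open>\<epsilon> > 0\<close> by (simp add: p_def)
  \<comment> \<open>The smallest weight \<open>m\<close> tells how large \<open>K\<close> must be
    for the history to fit into the envelope; the sum \<open>P\<close> of the weights bounds the
    norm of a state inside it. Their quotient is the constant \<open>c\<close> of exponential
    stability.\<close>
  define m where "m = Min (insert (sqrt Vs) (range p))"
  have m: "m > 0" "m \<le> sqrt Vs" "\<And>i. m \<le> p i"
    using p0 \<open>Vs > 0\<close> by (auto simp: m_def min_le_iff_disj)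
  define P where "P = sqrt Vs + (\<Sum>i\<in>UNIV. p i)"
  have "P \<ge> m"
    using m(2) sum_nonneg[of UNIV p] p0 by (simp add: P_def less_imp_le add_increasing2)
  have "norm (x t) \<le> P / m * exp (- b * t) * (SUP s\<in>{-r..0}. norm (\<phi> s))"
    if \<phi>: "continuous_on {-r..0} \<phi>"
      and x: "delay_solution r (district_heating Vs V q \<kappa> \<tau> (\<lambda>t. 0) (\<lambda>i t. 0)) \<phi> x"
      and "t \<ge> 0" for \<phi> x t
  proof -
    define N where "N = (SUP s\<in>{-r..0}. norm (\<phi> s))"
    \<comment> \<open>The supremum bounds the history only once the norms are known to be bounded,
      which follows from continuity on a compact interval.\<close>
    have "bdd_above ((\<lambda>s. norm (\<phi> s)) ` {-r..0})"
      using \<phi> by (intro bounded_imp_bdd_above compact_imp_bounded compact_continuous_image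
          continuous_intros) auto
    then have N: "norm (\<phi> s) \<le> N" if "-r \<le> s" "s \<le> 0" for s
      unfolding N_def by (rule cSUP_upper2) (use that in auto)
    have N0: "N \<ge> 0"
      using N[of 0] r0 order.trans[OF norm_ge_zero] by simp
    \<comment> \<open>The envelope must contain the history strictly, so \<open>K\<close> stays
      above \<open>N / m\<close>; this also gives \<open>K > 0\<close> for the zero history.\<close>
    have bound: "norm (x t) \<le> P * exp (- b * t) * K" if "N / m < K" for K
    proof -
      have "N < K * m"
        using that m(1) by (simp add: field_simps)
      have "K > 0"
        using that N0 m(1) by (meson divide_nonneg_pos le_less_trans)
      have Km: "N < K * w" if "m \<le> w" for w
        using \<open>N < K * m\<close> \<open>K > 0\<close> that by (meson less_le_trans mult_left_mono less_imp_le)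
      have "\<bar>fst (\<phi> s)\<bar> < K * sqrt Vs" if "-r \<le> s" "s \<le> 0" for s
        using norm_fst_le[of "fst (\<phi> s)" "snd (\<phi> s)"] N[OF that] Km[OF m(2)] by simp
      moreover have "\<bar>snd (\<phi> 0) $ i\<bar> < K * (sqrt (V i) * (1 + \<epsilon>))" for i
        using component_le_norm_cart[of "snd (\<phi> 0)" i] norm_snd_le[of "snd (\<phi> 0)" "fst (\<phi> 0)"]
          N[of 0] r0 Km[OF m(3)[of i]] by (simp add: p_def)
      moreover have "(1 + \<epsilon>) * (\<Sum>i\<in>UNIV. q i) \<le> (\<Sum>i\<in>UNIV. q i) + \<kappa> - b * Vs"
        using \<epsilon>Q b(2) by (simp add: distrib_right flip: Q_def)
      ultimately have x0: "\<bar>fst (x t)\<bar> < K * sqrt Vs * exp (- b * t)"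
        and xi: "\<bar>snd (x t) $ i\<bar> < K * p i * exp (- b * t)" for i
        unfolding p_def
        using district_heating_envelope[OF assms(1-3) _ \<tau>r _ \<open>K > 0\<close> _ b(3) x _ _ \<open>t \<ge> 0\<close>] \<tau> b(1)
        by (simp_all add: less_imp_le)
      have "norm (x t) \<le> \<bar>fst (x t)\<bar> + norm (snd (x t))"
        using norm_Pair_le[of "fst (x t)" "snd (x t)"] by simp
      also have "\<dots> \<le> \<bar>fst (x t)\<bar> + (\<Sum>i\<in>UNIV. \<bar>snd (x t) $ i\<bar>)"
        using norm_le_l1_cart by simp
      also have "\<dots> \<le> K * sqrt Vs * exp (- b * t) + (\<Sum>i\<in>UNIV. K * p i * exp (- b * t))"
        by (intro add_mono sum_mono less_imp_le x0 xi)
      also have "\<dots> = P * exp (- b * t) * K"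
        by (simp add: P_def sum_distrib_left sum_distrib_right algebra_simps)
      finally show ?thesis .
    qed
    \<comment> \<open>Letting \<open>K\<close> decrease to \<open>N / m\<close> removes the
      strictness.\<close>
    have "((\<lambda>K. P * exp (- b * t) * K) \<longlongrightarrow> P * exp (- b * t) * (N / m)) (at_right (N / m))"
      by (intro tendsto_intros)
    then have "norm (x t) \<le> P * exp (- b * t) * (N / m)"
      by (rule tendsto_lowerbound)
        (use eventually_mono[OF eventually_at_right_less bound] in auto)
    then show ?thesis
      by (simp add: N_def)
  qed
  moreover have "P / m \<ge> 1"
    using \<open>P \<ge> m\<close> m(1) by simp
  ultimately show "exponentially_stable (Max (range \<tau>))
      (district_heating Vs V q \<kappa> \<tau> (\<lambda>t. 0) (\<lambda>i t. 0))"
    unfolding exponentially_stable_def r_def[symmetric] using \<open>b > 0\<close> by blast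
qed

end
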